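(* Let $M$ be a finitely generated commutative monoid. Then the following conditions are equivalent: (1) $M$ is $s$-cancellative. (2) For any elements $x,y,a\in M$ with $xa=ya$ and any prime ideal $\mathfrak p$ of $M$ such that $x,y\notin\mathfrak p$, there exists an element $b\notin\mathfrak p$ such that $xb=yb$. (3) For any prime ideals $\mathfrak q\subset\mathfrak p$ of $M$ the induced map on invertible elements $(M_{\mathfrak p})^*\to(M_{\mathfrak q})^*$ is injective. (4) For any elements $x,y,a\in M$ with $xa=ya$ there exists an element $b\notin\mathfrak p_{xy}$ such that $xb=yb$.
   Context: Monoids are commutative, multiplicative, with unit. An ideal of $M$ is a (possibly empty) subset $I$ with $IM\subset I$; it is prime if $M\setminus I$ is a submonoid (so $\emptyset$ is a prime ideal). $M_{\mathfrak p}$ is the localization of $M$ at the submonoid $M\setminus\mathfrak p$, and $(-)^*$ denotes the group of invertible elements. For $c\in M$, $\mathfrak p_c$ is the union of all prime ideals of $M$ not containing $c$ (it is the largest prime ideal not containing $c$). A monoid $M$ is called $s$-cancellative if for any $a,x,y\in M$ with $ax=ay$ there is $n\in\mathbb{N}=\{0,1,2,\dots\}$ with $(xy)^nx=(xy)^ny$. *)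

theory Defs
  imports "HOL-Algebra.Coset"
begin

definition submonoid_generated :: "('a, 'b) monoid_scheme \<Rightarrow> 'a set \<Rightarrow> 'a set" where
  "submonoid_generated M A = \<Inter> {H. submonoid H M \<and> A \<subseteq> H}"

definition finitely_generated_monoid :: "('a, 'b) monoid_scheme \<Rightarrow> bool" where
  "finitely_generated_monoid M \<longleftrightarrow>
     (\<exists>A. finite A \<and> A \<subseteq> carrier M \<and> submonoid_generated M A = carrier M)"

(* The empty set is an ideal, and a prime one. *)
definition monoid_ideal :: "'a set \<Rightarrow> ('a, 'b) monoid_scheme \<Rightarrow> bool" where
  "monoid_ideal I M \<longleftrightarrow> I \<subseteq> carrier M \<and> I <#>\<^bsub>M\<^esub> carrier M \<subseteq> I"

definition monoid_primeideal :: "'a set \<Rightarrow> ('a, 'b) monoid_scheme \<Rightarrow> bool" where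
  "monoid_primeideal P M \<longleftrightarrow> monoid_ideal P M \<and> submonoid (carrier M - P) M"

(* The largest prime ideal of M not containing c. *)
definition primeideal_avoiding :: "('a, 'b) monoid_scheme \<Rightarrow> 'a \<Rightarrow> 'a set" where
  "primeideal_avoiding M c = \<Union> {P. monoid_primeideal P M \<and> c \<notin> P}"

definition s_cancellative :: "('a, 'b) monoid_scheme \<Rightarrow> bool" where
  "s_cancellative M \<longleftrightarrow>
     (\<forall>a \<in> carrier M. \<forall>x \<in> carrier M. \<forall>y \<in> carrier M.
        a \<otimes>\<^bsub>M\<^esub> x = a \<otimes>\<^bsub>M\<^esub> y \<longrightarrow>
        (\<exists>n::nat. (x \<otimes>\<^bsub>M\<^esub> y) [^]\<^bsub>M\<^esub> n \<otimes>\<^bsub>M\<^esub> x = (x \<otimes>\<^bsub>M\<^esub> y) [^]\<^bsub>M\<^esub> n \<otimes>\<^bsub>M\<^esub> y))"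

(* The pair (x, s) stands for the fraction x / s. *)
definition loc_rel :: "('a, 'b) monoid_scheme \<Rightarrow> 'a set \<Rightarrow> (('a \<times> 'a) \<times> ('a \<times> 'a)) set" where
  "loc_rel M S = {((x, s), (y, t)). x \<in> carrier M \<and> s \<in> S \<and> y \<in> carrier M \<and> t \<in> S \<and>
     (\<exists>u \<in> S. u \<otimes>\<^bsub>M\<^esub> (t \<otimes>\<^bsub>M\<^esub> x) = u \<otimes>\<^bsub>M\<^esub> (s \<otimes>\<^bsub>M\<^esub> y))}"

(* The fraction x / s, as an equivalence class of pairs. *)
definition loc_frac :: "('a, 'b) monoid_scheme \<Rightarrow> 'a set \<Rightarrow> 'a \<Rightarrow> 'a \<Rightarrow> ('a \<times> 'a) set" where
  "loc_frac M S x s = loc_rel M S `` {(x, s)}"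

definition localization :: "('a, 'b) monoid_scheme \<Rightarrow> 'a set \<Rightarrow> ('a \<times> 'a) set monoid" where
  "localization M S =
     \<lparr>carrier = (carrier M \<times> S) // loc_rel M S,
      mult = (\<lambda>X Y. \<Union>(x, s) \<in> X. \<Union>(y, t) \<in> Y. loc_frac M S (x \<otimes>\<^bsub>M\<^esub> y) (s \<otimes>\<^bsub>M\<^esub> t)),
      one = loc_frac M S \<one>\<^bsub>M\<^esub> \<one>\<^bsub>M\<^esub>\<rparr>"

definition localization_at :: "('a, 'b) monoid_scheme \<Rightarrow> 'a set \<Rightarrow> ('a \<times> 'a) set monoid" where
  "localization_at M P = localization M (carrier M - P)"

(* Meaningful for Q \<subseteq> P: the fraction x / s in M_P goes to the fraction x / s in M_Q,
   see localization_map_loc_frac below. *)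
definition localization_map ::
  "('a, 'b) monoid_scheme \<Rightarrow> 'a set \<Rightarrow> 'a set \<Rightarrow> ('a \<times> 'a) set \<Rightarrow> ('a \<times> 'a) set" where
  "localization_map M P Q X = (\<Union>(x, s) \<in> X. loc_frac M (carrier M - Q) x s)"

context comm_monoid
begin

lemma monoid_primeideal_avoiding:
  assumes c: "c \<in> carrier G"
  shows "monoid_primeideal (primeideal_avoiding G c) G" "c \<notin> primeideal_avoiding G c"
    "\<And>P. \<lbrakk>monoid_primeideal P G; c \<notin> P\<rbrakk> \<Longrightarrow> P \<subseteq> primeideal_avoiding G c"
proof -
  have ideal_iff: "monoid_ideal I G \<longleftrightarrow> I \<subseteq> carrier G \<and> (\<forall>i \<in> I. \<forall>m \<in> carrier G. i \<otimes> m \<in> I)"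
    for I
    unfolding monoid_ideal_def set_mult_def by blast
  have "submonoid (carrier G - primeideal_avoiding G c) G"
  proof
    fix x y
    assume "x \<in> carrier G - primeideal_avoiding G c" "y \<in> carrier G - primeideal_avoiding G c"
    then show "x \<otimes> y \<in> carrier G - primeideal_avoiding G c"
      unfolding primeideal_avoiding_def monoid_primeideal_def submonoid_def by blast
  next
    show "\<one> \<in> carrier G - primeideal_avoiding G c"
      unfolding primeideal_avoiding_def monoid_primeideal_def submonoid_def by blast
  qed blast
  moreover have "monoid_ideal (primeideal_avoiding G c) G"
    unfolding primeideal_avoiding_def monoid_primeideal_def ideal_iff by blast
  ultimately show "monoid_primeideal (primeideal_avoiding G c) G"
    unfolding monoid_primeideal_def by blast
qed (auto simp: primeideal_avoiding_def)

lemma loc_relI: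
  assumes "x \<in> carrier G" "y \<in> carrier G" "s \<in> S" "t \<in> S" "u \<in> S"
    "u \<otimes> (t \<otimes> x) = u \<otimes> (s \<otimes> y)"
  shows "((x, s), (y, t)) \<in> loc_rel G S"
  using assms unfolding loc_rel_def by blast

lemma equiv_loc_rel:
  assumes "submonoid S G"
  shows "equiv (carrier G \<times> S) (loc_rel G S)"
proof -
  interpret S: submonoid S G by fact
  have "trans (loc_rel G S)"
  proof (rule transI, clarify)
    fix x s y t z r
    assume "((x, s), (y, t)) \<in> loc_rel G S" "((y, t), (z, r)) \<in> loc_rel G S"
    then obtain u v where m: "x \<in> carrier G" "y \<in> carrier G" "z \<in> carrier G"
        "s \<in> S" "t \<in> S" "r \<in> S" "u \<in> S" "v \<in> S"
      and 1: "u \<otimes> (t \<otimes> x) = u \<otimes> (s \<otimes> y)" and 2: "v \<otimes> (r \<otimes> y) = v \<otimes> (t \<otimes> z)"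
      unfolding loc_rel_def by blast
    note c = m(1-3) m(4-8)[THEN S.mem_carrier]
    have "(u \<otimes> v \<otimes> t) \<otimes> (r \<otimes> x) = (v \<otimes> r) \<otimes> (u \<otimes> (t \<otimes> x))"
      using c by (simp add: m_ac)
    also have "\<dots> = (u \<otimes> s) \<otimes> (v \<otimes> (r \<otimes> y))"
      unfolding 1 using c by (simp add: m_ac)
    also have "\<dots> = (u \<otimes> v \<otimes> t) \<otimes> (s \<otimes> z)"
      unfolding 2 using c by (simp add: m_ac)
    finally show "((x, s), (z, r)) \<in> loc_rel G S"
      using m by (intro loc_relI[where u = "u \<otimes> v \<otimes> t"]) auto
  qed
  moreover have "refl_on (carrier G \<times> S) (loc_rel G S)"
    unfolding refl_on_def loc_rel_def by (auto intro: S.one_closed)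
  moreover have "sym (loc_rel G S)"
    by (rule symI) (clarsimp simp: loc_rel_def; metis)
  moreover have "loc_rel G S \<subseteq> (carrier G \<times> S) \<times> (carrier G \<times> S)"
    unfolding loc_rel_def by auto
  ultimately show ?thesis
    by (simp add: equiv_def)
qed

lemma loc_frac_eq_iff:
  assumes "submonoid S G" "x \<in> carrier G" "y \<in> carrier G" "s \<in> S" "t \<in> S"
  shows "loc_frac G S x s = loc_frac G S y t \<longleftrightarrow> (\<exists>u \<in> S. u \<otimes> (t \<otimes> x) = u \<otimes> (s \<otimes> y))"
  unfolding loc_frac_def using equiv_loc_rel[OF assms(1)] assms(2-5)
  by (subst eq_equiv_class_iff) (auto simp: loc_rel_def)

lemma carrier_localization:
  "carrier (localization G S) = {loc_frac G S x s | x s. x \<in> carrier G \<and> s \<in> S}"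
  unfolding localization_def loc_frac_def quotient_def by auto

lemma UN_loc_frac:
  assumes S: "submonoid S G" and x: "x \<in> carrier G" "s \<in> S"
    and f: "\<And>y t. \<lbrakk>y \<in> carrier G; t \<in> S; ((x, s), (y, t)) \<in> loc_rel G S\<rbrakk> \<Longrightarrow> f y t = f x s"
  shows "(\<Union>(y, t) \<in> loc_frac G S x s. f y t) = f x s"
proof -
  have "(x, s) \<in> loc_frac G S x s"
    unfolding loc_frac_def using equiv_class_self[OF equiv_loc_rel[OF S]] x by auto
  moreover have "\<forall>p \<in> loc_frac G S x s. case_prod f p = f x s"
    using f by (auto simp: loc_frac_def loc_rel_def)
  ultimately show ?thesis
    by (intro UN_constant_eq) auto
qed

lemma loc_frac_mult:
  assumes S: "submonoid S G" and m: "x \<in> carrier G" "y \<in> carrier G" "s \<in> S" "t \<in> S"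
  shows "loc_frac G S x s \<otimes>\<^bsub>localization G S\<^esub> loc_frac G S y t = loc_frac G S (x \<otimes> y) (s \<otimes> t)"
proof -
  interpret S: submonoid S G by fact
  have cong: "loc_frac G S (x' \<otimes> y') (s' \<otimes> t') = loc_frac G S (x \<otimes> y) (s \<otimes> t)"
    if "x \<in> carrier G" "s \<in> S" "y \<in> carrier G" "t \<in> S"
      "((x, s), (x', s')) \<in> loc_rel G S" "((y, t), (y', t')) \<in> loc_rel G S" for x y s t x' s' y' t'
  proof -
    from that obtain u v where m: "x \<in> carrier G" "y \<in> carrier G" "x' \<in> carrier G" "y' \<in> carrier G"
        "s \<in> S" "t \<in> S" "s' \<in> S" "t' \<in> S" "u \<in> S" "v \<in> S"
      and 1: "u \<otimes> (s' \<otimes> x) = u \<otimes> (s \<otimes> x')" and 2: "v \<otimes> (t' \<otimes> y) = v \<otimes> (t \<otimes> y')"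
      unfolding loc_rel_def by blast
    note c = m(1-4) m(5-10)[THEN S.mem_carrier]
    have "(u \<otimes> v) \<otimes> ((s \<otimes> t) \<otimes> (x' \<otimes> y')) = (u \<otimes> (s \<otimes> x')) \<otimes> (v \<otimes> (t \<otimes> y'))"
      using c by (simp add: m_ac)
    also have "\<dots> = (u \<otimes> v) \<otimes> ((s' \<otimes> t') \<otimes> (x \<otimes> y))"
      unfolding 1[symmetric] 2[symmetric] using c by (simp add: m_ac)
    finally show ?thesis
      using m S by (subst loc_frac_eq_iff) auto
  qed
  have refl: "((z, r), (z, r)) \<in> loc_rel G S" if "z \<in> carrier G" "r \<in> S" for z r
    using equiv_loc_rel[OF S] that by (auto simp: equiv_def refl_on_def)
  have inner: "(\<Union>(y', t') \<in> loc_frac G S y t. loc_frac G S (x' \<otimes> y') (s' \<otimes> t')) =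
      loc_frac G S (x' \<otimes> y) (s' \<otimes> t)"
    if "x' \<in> carrier G" "s' \<in> S" for x' s'
    by (rule UN_loc_frac[OF S m(2) m(4)]) (rule cong; use that m refl in auto)
  have "loc_frac G S x s \<otimes>\<^bsub>localization G S\<^esub> loc_frac G S y t =
      (\<Union>(x', s') \<in> loc_frac G S x s. \<Union>(y', t') \<in> loc_frac G S y t. loc_frac G S (x' \<otimes> y') (s' \<otimes> t'))"
    by (simp add: localization_def)
  also have "\<dots> = (\<Union>(y', t') \<in> loc_frac G S y t. loc_frac G S (x \<otimes> y') (s \<otimes> t'))"
  proof (rule UN_loc_frac[OF S m(1) m(3)])
    fix x' s' assume a: "x' \<in> carrier G" "s' \<in> S" "((x, s), (x', s')) \<in> loc_rel G S"
    show "(\<Union>(y', t') \<in> loc_frac G S y t. loc_frac G S (x' \<otimes> y') (s' \<otimes> t')) =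
        (\<Union>(y', t') \<in> loc_frac G S y t. loc_frac G S (x \<otimes> y') (s \<otimes> t'))"
      unfolding inner[OF a(1,2)] inner[OF m(1,3)] by (rule cong) (use a m refl in auto)
  qed
  also have "\<dots> = loc_frac G S (x \<otimes> y) (s \<otimes> t)"
    using inner[OF m(1,3)] .
  finally show ?thesis .
qed

lemma comm_monoid_localization:
  assumes S: "submonoid S G"
  shows "comm_monoid (localization G S)"
proof -
  interpret S: submonoid S G by fact
  have one: "\<one>\<^bsub>localization G S\<^esub> = loc_frac G S \<one> \<one>"
    by (simp add: localization_def)
  show ?thesis
  proof (rule comm_monoidI)
    fix X Y assume "X \<in> carrier (localization G S)" "Y \<in> carrier (localization G S)"
    then show "X \<otimes>\<^bsub>localization G S\<^esub> Y \<in> carrier (localization G S)"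
      by (auto simp: carrier_localization loc_frac_mult[OF S]) blast
  next
    show "\<one>\<^bsub>localization G S\<^esub> \<in> carrier (localization G S)"
      unfolding carrier_localization one using S.one_closed by blast
  qed (auto simp: carrier_localization one loc_frac_mult[OF S] m_ac)
qed

lemma localization_map_loc_frac:
  assumes "monoid_primeideal P G" "monoid_primeideal Q G" "Q \<subseteq> P"
    and "x \<in> carrier G" "s \<in> carrier G - P"
  shows "localization_map G P Q (loc_frac G (carrier G - P) x s) = loc_frac G (carrier G - Q) x s"
proof -
  have P: "submonoid (carrier G - P) G" and Q: "submonoid (carrier G - Q) G"
    using assms by (auto simp: monoid_primeideal_def)
  show ?thesis
    unfolding localization_map_def
  proof (rule UN_loc_frac[OF P assms(4,5)])
    fix y t assume a: "y \<in> carrier G" "t \<in> carrier G - P"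
      "((x, s), (y, t)) \<in> loc_rel G (carrier G - P)"
    then obtain u where "u \<in> carrier G - P" "u \<otimes> (t \<otimes> x) = u \<otimes> (s \<otimes> y)"
      unfolding loc_rel_def by blast
    then show "loc_frac G (carrier G - Q) y t = loc_frac G (carrier G - Q) x s"
      using a assms by (subst loc_frac_eq_iff[OF Q]) (auto intro!: bexI[of _ u])
  qed
qed

lemma localization_map_hom:
  assumes "monoid_primeideal P G" "monoid_primeideal Q G" "Q \<subseteq> P"
  shows "localization_map G P Q \<in> hom (localization_at G P) (localization_at G Q)"
    and "localization_map G P Q \<one>\<^bsub>localization_at G P\<^esub> = \<one>\<^bsub>localization_at G Q\<^esub>"
proof -
  have P: "submonoid (carrier G - P) G" and Q: "submonoid (carrier G - Q) G"
    using assms by (auto simp: monoid_primeideal_def)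
  interpret P: submonoid "carrier G - P" G by fact
  have f: "localization_map G P Q (loc_frac G (carrier G - P) x s) = loc_frac G (carrier G - Q) x s"
    if "x \<in> carrier G" "s \<in> carrier G - P" for x s
    using localization_map_loc_frac[OF assms that] .
  have QP: "s \<in> carrier G - Q" if "s \<in> carrier G - P" for s
    using that assms(3) by blast
  show "localization_map G P Q \<in> hom (localization_at G P) (localization_at G Q)"
  proof (rule homI)
    fix X assume "X \<in> carrier (localization_at G P)"
    then show "localization_map G P Q X \<in> carrier (localization_at G Q)"
      unfolding localization_at_def carrier_localization using f QP by blast
  next
    fix X Y assume "X \<in> carrier (localization_at G P)" "Y \<in> carrier (localization_at G P)"
    then obtain x s y t where m: "x \<in> carrier G" "s \<in> carrier G - P" "y \<in> carrier G" "t \<in> carrier G - P"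
      and XY: "X = loc_frac G (carrier G - P) x s" "Y = loc_frac G (carrier G - P) y t"
      unfolding localization_at_def carrier_localization by blast
    have "localization_map G P Q (X \<otimes>\<^bsub>localization_at G P\<^esub> Y) =
        localization_map G P Q (loc_frac G (carrier G - P) (x \<otimes> y) (s \<otimes> t))"
      unfolding XY localization_at_def using m by (simp only: loc_frac_mult[OF P])
    also have "\<dots> = loc_frac G (carrier G - Q) (x \<otimes> y) (s \<otimes> t)"
      using m P.m_closed by (intro f) auto
    also have "\<dots> = loc_frac G (carrier G - Q) x s \<otimes>\<^bsub>localization_at G Q\<^esub> loc_frac G (carrier G - Q) y t"
      unfolding localization_at_def using m QP by (simp only: loc_frac_mult[OF Q])
    also have "\<dots> = localization_map G P Q X \<otimes>\<^bsub>localization_at G Q\<^esub> localization_map G P Q Y"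
      unfolding XY using m by (simp only: f)
    finally show "localization_map G P Q (X \<otimes>\<^bsub>localization_at G P\<^esub> Y) =
        localization_map G P Q X \<otimes>\<^bsub>localization_at G Q\<^esub> localization_map G P Q Y" .
  qed
  show "localization_map G P Q \<one>\<^bsub>localization_at G P\<^esub> = \<one>\<^bsub>localization_at G Q\<^esub>"
    using f[OF one_closed P.one_closed] by (simp add: localization_at_def localization_def)
qed

lemma localization_map_Units:
  assumes "monoid_primeideal P G" "monoid_primeideal Q G" "Q \<subseteq> P"
  shows "localization_map G P Q ` Units (localization_at G P) \<subseteq> Units (localization_at G Q)"
proof clarify
  fix X assume "X \<in> Units (localization_at G P)"
  then obtain Y where XY: "X \<in> carrier (localization_at G P)" "Y \<in> carrier (localization_at G P)"
    "X \<otimes>\<^bsub>localization_at G P\<^esub> Y = \<one>\<^bsub>localization_at G P\<^esub>"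
    "Y \<otimes>\<^bsub>localization_at G P\<^esub> X = \<one>\<^bsub>localization_at G P\<^esub>"
    unfolding Units_def by blast
  note h = localization_map_hom[OF assms]
  have "localization_map G P Q X \<otimes>\<^bsub>localization_at G Q\<^esub> localization_map G P Q Y
        = \<one>\<^bsub>localization_at G Q\<^esub>"
    "localization_map G P Q Y \<otimes>\<^bsub>localization_at G Q\<^esub> localization_map G P Q X
        = \<one>\<^bsub>localization_at G Q\<^esub>"
    using XY h(2) hom_mult[OF h(1)] by metis+
  then show "localization_map G P Q X \<in> Units (localization_at G Q)"
    using XY hom_in_carrier[OF h(1)] unfolding Units_def by blast
qed

end

end

theory Submission
  imports Defs
begin

text \<open>
  The complement of \<open>\<pp>\<^sub>c\<close> consists of the divisors of powers of \<open>c\<close>. Multiplying an equation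
  \<open>b x = b y\<close>, with \<open>b\<close> outside \<open>\<pp>\<^sub>x\<^sub>y\<close>, by a cofactor of \<open>b\<close> in \<open>(x y)\<^sup>n\<close> turns condition (4)
  into s-cancellativity. Conditions (2) and (4) agree because \<open>\<pp>\<^sub>x\<^sub>y\<close> is the largest prime ideal
  containing neither \<open>x\<close> nor \<open>y\<close>. Finally \<open>x / s\<close> is invertible in \<open>M\<^sub>\<pp>\<close> iff \<open>x \<notin> \<pp>\<close>; since the
  empty ideal is prime, \<open>x a = y a\<close> says that \<open>x / 1 = y / 1\<close> in the localization at some prime
  \<open>\<qq> \<subseteq> \<pp>\<close>, and injectivity on invertible elements becomes condition (2).
\<close>

context comm_monoid
begin

section \<open>Prime ideals and divisibility\<close>

lemma primeideal_closed:
  assumes "monoid_primeideal P G" "x \<in> P" "y \<in> carrier G"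
  shows "x \<otimes> y \<in> P"
  using assms unfolding monoid_primeideal_def monoid_ideal_def set_mult_def by blast

text \<open>Absorption in the ideal makes the complement closed under divisors; primality makes it
  closed under products.\<close>

lemma primeideal_mult_notin_iff:
  assumes P: "monoid_primeideal P G" and x: "x \<in> carrier G" and y: "y \<in> carrier G"
  shows "x \<otimes> y \<notin> P \<longleftrightarrow> x \<notin> P \<and> y \<notin> P"
proof
  assume "x \<otimes> y \<notin> P"
  then show "x \<notin> P \<and> y \<notin> P"
    using primeideal_closed[OF P _ y, of x] primeideal_closed[OF P _ x, of y] x y
    by (auto simp: m_comm)
next
  interpret S: submonoid "carrier G - P" G
    using P by (simp add: monoid_primeideal_def)
  assume "x \<notin> P \<and> y \<notin> P"
  then show "x \<otimes> y \<notin> P"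
    using S.m_closed[of x y] x y by blast
qed

lemma primeideal_pow_notin:
  assumes P: "monoid_primeideal P G" and x: "x \<in> carrier G" "x \<notin> P"
  shows "x [^] (n::nat) \<notin> P"
proof (induction n)
  case 0
  show ?case
    using P by (simp add: monoid_primeideal_def submonoid_def)
next
  case (Suc n)
  then show ?case
    using x by (simp add: primeideal_mult_notin_iff[OF P])
qed

text \<open>A prime ideal missing \<open>c\<close> misses every power of \<open>c\<close>, hence
  every divisor of such a power. Conversely, these divisors form a submonoid closed under divisors,
  so their complement is a prime ideal missing \<open>c\<close> and lies below the largest
  one.\<close>

lemma notin_primeideal_avoiding_iff:
  assumes b: "b \<in> carrier G" and c: "c \<in> carrier G"
  shows "b \<notin> primeideal_avoiding G c \<longleftrightarrow> (\<exists>m \<in> carrier G. \<exists>n::nat. b \<otimes> m = c [^] n)"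
proof
  assume "\<exists>m \<in> carrier G. \<exists>n::nat. b \<otimes> m = c [^] n"
  then obtain m and n :: nat where m: "m \<in> carrier G" and "b \<otimes> m = c [^] n"
    by blast
  then have "b \<otimes> m \<notin> primeideal_avoiding G c"
    using primeideal_pow_notin[OF monoid_primeideal_avoiding(1)[OF c] c
      monoid_primeideal_avoiding(2)[OF c]] by simp
  then show "b \<notin> primeideal_avoiding G c"
    using primeideal_mult_notin_iff[OF monoid_primeideal_avoiding(1)[OF c] b m] by blast
next
  define D where "D = {d \<in> carrier G. \<exists>m \<in> carrier G. \<exists>n::nat. d \<otimes> m = c [^] n}"
  have "submonoid D G"
  proof
    fix d e assume "d \<in> D" "e \<in> D"
    then obtain m k and n l :: nat where d: "d \<in> carrier G" "m \<in> carrier G" "d \<otimes> m = c [^] n"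
      and e: "e \<in> carrier G" "k \<in> carrier G" "e \<otimes> k = c [^] l"
      unfolding D_def by blast
    have "(d \<otimes> e) \<otimes> (m \<otimes> k) = (d \<otimes> m) \<otimes> (e \<otimes> k)"
      using d(1,2) e(1,2) by (simp add: m_ac)
    also have "\<dots> = c [^] (n + l)"
      using c d e by (simp add: nat_pow_mult)
    finally show "d \<otimes> e \<in> D"
      unfolding D_def using d e by blast
  next
    have "\<one> \<otimes> \<one> = c [^] (0::nat)"
      by simp
    then show "\<one> \<in> D"
      unfolding D_def by blast
  qed (auto simp: D_def)
  moreover have "monoid_ideal (carrier G - D) G"
  proof -
    \<comment> \<open>If \<open>m\<close> is a cofactor of \<open>d \<otimes> e\<close>, then
      \<open>e \<otimes> m\<close> is a cofactor of \<open>d\<close>. Thus the complement of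
      \<open>D\<close> absorbs products.\<close>
    have "d \<in> D" if "d \<in> carrier G" "e \<in> carrier G" "d \<otimes> e \<in> D" for d e
      using that unfolding D_def by (auto simp: m_assoc)
    then show ?thesis
      unfolding monoid_ideal_def set_mult_def by blast
  qed
  moreover have "carrier G - (carrier G - D) = D"
    unfolding D_def by blast
  ultimately have "monoid_primeideal (carrier G - D) G"
    by (simp add: monoid_primeideal_def)
  moreover have "c \<in> D"
  proof -
    have "c \<otimes> \<one> = c [^] (1::nat)"
      using c by simp
    then show ?thesis
      unfolding D_def using c by blast
  qed
  ultimately have "carrier G - D \<subseteq> primeideal_avoiding G c"
    using monoid_primeideal_avoiding(3)[OF c] by blast
  moreover assume "b \<notin> primeideal_avoiding G c"
  ultimately show "\<exists>m \<in> carrier G. \<exists>n::nat. b \<otimes> m = c [^] n"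
    using b unfolding D_def by blast
qed

section \<open>Equalizing elements outside prime ideals\<close>

text \<open>An element that equalizes \<open>x\<close> and \<open>y\<close> can be replaced by any
  multiple of it, in particular by a power of \<open>c\<close> that it divides. The element
  \<open>c\<close> stays arbitrary here; the application takes
  \<open>c = x \<otimes> y\<close>.\<close>

lemma equalizer_avoiding_iff:
  assumes x: "x \<in> carrier G" and y: "y \<in> carrier G" and c: "c \<in> carrier G"
  shows "(\<exists>b \<in> carrier G. b \<notin> primeideal_avoiding G c \<and> x \<otimes> b = y \<otimes> b) \<longleftrightarrow>
    (\<exists>n::nat. c [^] n \<otimes> x = c [^] n \<otimes> y)"
proof
  assume "\<exists>b \<in> carrier G. b \<notin> primeideal_avoiding G c \<and> x \<otimes> b = y \<otimes> b"
  then obtain b m and n :: nat where b: "b \<in> carrier G" "m \<in> carrier G"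
    and eq: "x \<otimes> b = y \<otimes> b" and n: "b \<otimes> m = c [^] n"
    using notin_primeideal_avoiding_iff[OF _ c] by blast
  have "c [^] n \<otimes> x = m \<otimes> (x \<otimes> b)"
    unfolding n[symmetric] using x b by (simp add: m_ac)
  also have "\<dots> = c [^] n \<otimes> y"
    unfolding n[symmetric] eq using y b by (simp add: m_ac)
  finally show "\<exists>n::nat. c [^] n \<otimes> x = c [^] n \<otimes> y"
    by blast
next
  assume "\<exists>n::nat. c [^] n \<otimes> x = c [^] n \<otimes> y"
  then obtain n :: nat where n: "c [^] n \<otimes> x = c [^] n \<otimes> y"
    by blast
  then have "x \<otimes> c [^] n = y \<otimes> c [^] n"
    using x y c by (simp add: m_comm)
  moreover have "c [^] n \<notin> primeideal_avoiding G c"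
    using primeideal_pow_notin monoid_primeideal_avoiding(1,2) c by blast
  ultimately show "\<exists>b \<in> carrier G. b \<notin> primeideal_avoiding G c \<and> x \<otimes> b = y \<otimes> b"
    using c by blast
qed

lemma s_cancellative_iff_avoiding:
  "s_cancellative G \<longleftrightarrow>
    (\<forall>x \<in> carrier G. \<forall>y \<in> carrier G. \<forall>a \<in> carrier G.
       x \<otimes> a = y \<otimes> a \<longrightarrow>
       (\<exists>b \<in> carrier G. b \<notin> primeideal_avoiding G (x \<otimes> y) \<and> x \<otimes> b = y \<otimes> b))"
proof -
  have "(a \<otimes> x = a \<otimes> y \<longrightarrow> (\<exists>n::nat. (x \<otimes> y) [^] n \<otimes> x = (x \<otimes> y) [^] n \<otimes> y)) \<longleftrightarrow>
      (x \<otimes> a = y \<otimes> a \<longrightarrow>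
        (\<exists>b \<in> carrier G. b \<notin> primeideal_avoiding G (x \<otimes> y) \<and> x \<otimes> b = y \<otimes> b))"
    if "a \<in> carrier G" "x \<in> carrier G" "y \<in> carrier G" for a x y
    unfolding equalizer_avoiding_iff[OF that(2,3) m_closed[OF that(2,3)]]
      m_comm[OF that(1,2)] m_comm[OF that(1,3)] by (rule refl)
  then show ?thesis
    unfolding s_cancellative_def by blast
qed

text \<open>The prime ideals missing both \<open>x\<close> and \<open>y\<close> are those missing
  \<open>x \<otimes> y\<close>. The largest of them has the smallest complement, so a
  \<open>b\<close> found there serves for all the others.\<close>

lemma equalizer_primeideals_iff_avoiding:
  assumes x: "x \<in> carrier G" and y: "y \<in> carrier G"
  shows "(\<forall>P. monoid_primeideal P G \<longrightarrow> x \<notin> P \<longrightarrow> y \<notin> P \<longrightarrow>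
      (\<exists>b \<in> carrier G. b \<notin> P \<and> x \<otimes> b = y \<otimes> b)) \<longleftrightarrow>
    (\<exists>b \<in> carrier G. b \<notin> primeideal_avoiding G (x \<otimes> y) \<and> x \<otimes> b = y \<otimes> b)"
    (is "?all \<longleftrightarrow> ?avoiding")
proof
  note xy = m_closed[OF x y]
  note prime = monoid_primeideal_avoiding(1)[OF xy]
  assume ?all
  then show ?avoiding
    using prime primeideal_mult_notin_iff[OF prime x y] monoid_primeideal_avoiding(2)[OF xy]
    by blast
next
  assume ?avoiding
  then show ?all
    using monoid_primeideal_avoiding(3)[OF m_closed[OF x y]] primeideal_mult_notin_iff[OF _ x y]
    by blast
qed

section \<open>Invertible fractions and maps between localizations\<close>

text \<open>If \<open>x\<close> lies outside \<open>P\<close>, then \<open>s / x\<close> is a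
  fraction inverse to \<open>x / s\<close>. Conversely, an inverse makes \<open>x\<close> a divisor
  of a product of elements outside \<open>P\<close>.\<close>

lemma loc_frac_Units_iff:
  assumes P: "monoid_primeideal P G" and x: "x \<in> carrier G" and s: "s \<in> carrier G - P"
  shows "loc_frac G (carrier G - P) x s \<in> Units (localization_at G P) \<longleftrightarrow> x \<notin> P"
proof -
  have S: "submonoid (carrier G - P) G"
    using P by (simp add: monoid_primeideal_def)
  interpret S: submonoid "carrier G - P" G by (fact S)
  interpret L: comm_monoid "localization_at G P"
    unfolding localization_at_def by (rule comm_monoid_localization[OF S])
  have one: "\<one>\<^bsub>localization_at G P\<^esub> = loc_frac G (carrier G - P) \<one> \<one>"
    by (simp add: localization_at_def localization_def)
  have carr: "loc_frac G (carrier G - P) z r \<in> carrier (localization_at G P)"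
    if "z \<in> carrier G" "r \<in> carrier G - P" for z r
    using that unfolding localization_at_def carrier_localization by blast
  \<comment> \<open>This is the equality of \<open>(x \<otimes> z) / (s \<otimes> r)\<close> and
    \<open>1 / 1\<close>, cross-multiplied.\<close>
  have inverse_iff: "loc_frac G (carrier G - P) x s \<otimes>\<^bsub>localization_at G P\<^esub>
      loc_frac G (carrier G - P) z r = \<one>\<^bsub>localization_at G P\<^esub> \<longleftrightarrow>
    (\<exists>u \<in> carrier G - P. u \<otimes> (x \<otimes> z) = u \<otimes> (s \<otimes> r))"
    if z: "z \<in> carrier G" and r: "r \<in> carrier G - P" for z r
  proof -
    have "s \<otimes> r \<in> carrier G - P"
      using s r by (rule S.m_closed)
    then show ?thesis
      unfolding one unfolding localization_at_def loc_frac_mult[OF S x z s r]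
      using x z s r S.one_closed by (subst loc_frac_eq_iff[OF S]) auto
  qed
  show ?thesis
  proof
    assume "loc_frac G (carrier G - P) x s \<in> Units (localization_at G P)"
    then obtain Z where "Z \<in> carrier (localization_at G P)"
      and inverse: "loc_frac G (carrier G - P) x s \<otimes>\<^bsub>localization_at G P\<^esub> Z =
        \<one>\<^bsub>localization_at G P\<^esub>"
      unfolding Units_def by blast
    moreover from this(1) obtain z r where z: "z \<in> carrier G" and r: "r \<in> carrier G - P"
      and "Z = loc_frac G (carrier G - P) z r"
      unfolding localization_at_def carrier_localization by blast
    ultimately obtain u where u: "u \<in> carrier G - P" and eq: "u \<otimes> (x \<otimes> z) = u \<otimes> (s \<otimes> r)"
      using inverse_iff[OF z r] by blast
    have "u \<otimes> (x \<otimes> z) \<notin> P"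
      unfolding eq using u s r by (simp add: primeideal_mult_notin_iff[OF P])
    then show "x \<notin> P"
      using u x z by (simp add: primeideal_mult_notin_iff[OF P])
  next
    assume "x \<notin> P"
    then have x': "x \<in> carrier G - P"
      using x by blast
    have "\<one> \<otimes> (x \<otimes> s) = \<one> \<otimes> (s \<otimes> x)"
      using x s by (simp add: m_comm)
    then have inverse: "loc_frac G (carrier G - P) x s \<otimes>\<^bsub>localization_at G P\<^esub>
        loc_frac G (carrier G - P) s x = \<one>\<^bsub>localization_at G P\<^esub>"
      using inverse_iff[of s x] s x' S.one_closed by blast
    have s': "s \<in> carrier G"
      using s by blast
    show "loc_frac G (carrier G - P) x s \<in> Units (localization_at G P)"
      using inverse carr[OF x s] carr[OF s' x'] L.m_comm[OF carr[OF x s] carr[OF s' x']]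
      unfolding Units_def by auto
  qed
qed

text \<open>Localizing at \<open>{}\<close> inverts every element and so gives the group completion,
  the target used for injectivity below.\<close>

lemma monoid_primeideal_empty: "monoid_primeideal {} G"
  unfolding monoid_primeideal_def monoid_ideal_def set_mult_def by (simp add: submonoid_def)

text \<open>Forwards, \<open>Q = {}\<close> turns the given equation into an equality of images of
  units. Backwards, cross-multiplying two fractions with equal images produces an equation to which
  the equalizer condition applies.\<close>

lemma inj_on_localization_map_iff:
  "(\<forall>P Q. monoid_primeideal P G \<longrightarrow> monoid_primeideal Q G \<longrightarrow> Q \<subseteq> P \<longrightarrow>
      inj_on (localization_map G P Q) (Units (localization_at G P))) \<longleftrightarrow>
   (\<forall>x \<in> carrier G. \<forall>y \<in> carrier G. \<forall>a \<in> carrier G. \<forall>P.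
      x \<otimes> a = y \<otimes> a \<longrightarrow> monoid_primeideal P G \<longrightarrow> x \<notin> P \<longrightarrow> y \<notin> P \<longrightarrow>
      (\<exists>b \<in> carrier G. b \<notin> P \<and> x \<otimes> b = y \<otimes> b))"
  (is "?inj \<longleftrightarrow> ?eq")
proof
  assume inj: ?inj
  show ?eq
  proof (intro ballI allI impI)
    fix x y a P
    assume x: "x \<in> carrier G" "x \<notin> P" and y: "y \<in> carrier G" "y \<notin> P" and a: "a \<in> carrier G"
      and eq: "x \<otimes> a = y \<otimes> a" and P: "monoid_primeideal P G"
    have S: "submonoid (carrier G - P) G" and T: "submonoid (carrier G - {}) G"
      using P monoid_primeideal_empty by (simp_all only: monoid_primeideal_def)
    have one: "\<one> \<in> carrier G - P"
      using S by (rule submonoid.one_closed)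
    \<comment> \<open>Every element is an admissible denominator here, so \<open>a\<close> itself
      witnesses the equality of fractions.\<close>
    have "loc_frac G (carrier G - {}) x \<one> = loc_frac G (carrier G - {}) y \<one>"
      using x y a eq by (subst loc_frac_eq_iff[OF T]) (auto simp: m_comm intro!: bexI[of _ a])
    then have "localization_map G P {} (loc_frac G (carrier G - P) x \<one>) =
        localization_map G P {} (loc_frac G (carrier G - P) y \<one>)"
      using x y by (simp only: localization_map_loc_frac[OF P monoid_primeideal_empty empty_subsetI _ one])
    moreover have "inj_on (localization_map G P {}) (Units (localization_at G P))"
      using inj P monoid_primeideal_empty by blast
    \<comment> \<open>Since \<open>x\<close> and \<open>y\<close> lie outside \<open>P\<close>, both
      fractions are units, and injectivity applies to them.\<close>
    ultimately have "loc_frac G (carrier G - P) x \<one> = loc_frac G (carrier G - P) y \<one>"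
      using loc_frac_Units_iff[OF P _ one] x y by (auto dest: inj_onD)
    then obtain b where "b \<in> carrier G - P" "b \<otimes> (\<one> \<otimes> x) = b \<otimes> (\<one> \<otimes> y)"
      using loc_frac_eq_iff[OF S x(1) y(1) one one] by blast
    then show "\<exists>b \<in> carrier G. b \<notin> P \<and> x \<otimes> b = y \<otimes> b"
      using x y by (auto simp: m_comm intro!: bexI[of _ b])
  qed
next
  assume eq: ?eq
  show ?inj
  proof (intro allI impI inj_onI)
    fix P Q X Y
    assume P: "monoid_primeideal P G" and Q: "monoid_primeideal Q G" and sub: "Q \<subseteq> P"
      and units: "X \<in> Units (localization_at G P)" "Y \<in> Units (localization_at G P)"
      and XY: "localization_map G P Q X = localization_map G P Q Y"
    have S: "submonoid (carrier G - P) G" and T: "submonoid (carrier G - Q) G"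
      using P Q by (simp_all only: monoid_primeideal_def)
    obtain x s y t where x: "x \<in> carrier G" and s: "s \<in> carrier G - P"
      and y: "y \<in> carrier G" and t: "t \<in> carrier G - P"
      and X: "X = loc_frac G (carrier G - P) x s" and Y: "Y = loc_frac G (carrier G - P) y t"
      using units unfolding Units_def localization_at_def carrier_localization by blast
    have "x \<notin> P" "y \<notin> P"
      using units x y s t by (simp_all add: X Y loc_frac_Units_iff[OF P])
    \<comment> \<open>The cross-multiplied numerators will be the pair to which \<open>eq\<close>
      applies, so both must lie outside \<open>P\<close>.\<close>
    then have notin: "t \<otimes> x \<notin> P" "s \<otimes> y \<notin> P"
      using x y s t by (simp_all add: primeideal_mult_notin_iff[OF P])
    have "loc_frac G (carrier G - Q) x s = loc_frac G (carrier G - Q) y t"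
      using XY x y s t by (simp add: X Y localization_map_loc_frac[OF P Q sub])
    \<comment> \<open>This \<open>u\<close> is only known to avoid \<open>Q\<close> and may lie in
      \<open>P\<close>. It takes the role of \<open>a\<close> in \<open>eq\<close>, which exchanges
      it for a \<open>b\<close> outside \<open>P\<close>.\<close>
    then obtain u where u: "u \<in> carrier G" and "u \<otimes> (t \<otimes> x) = u \<otimes> (s \<otimes> y)"
      using loc_frac_eq_iff[OF T x y, of s t] s t sub by blast
    moreover have tx: "t \<otimes> x \<in> carrier G" and sy: "s \<otimes> y \<in> carrier G"
      using x y s t by simp_all
    ultimately have "t \<otimes> x \<otimes> u = s \<otimes> y \<otimes> u"
      by (simp only: m_comm[OF u])
    then obtain b where b: "b \<in> carrier G" "b \<notin> P" and "t \<otimes> x \<otimes> b = s \<otimes> y \<otimes> b"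
      using eq[rule_format, OF tx sy u _ P notin] by blast
    then have "b \<otimes> (t \<otimes> x) = b \<otimes> (s \<otimes> y)"
      by (simp only: m_comm[OF b(1)] tx sy)
    then show "X = Y"
      unfolding X Y using loc_frac_eq_iff[OF S x y s t] b by blast
  qed
qed

end

theorem theorem6p2:
  fixes M :: "('a, 'b) monoid_scheme" (structure)
  assumes "comm_monoid M"
    and "finitely_generated_monoid M"
  shows "(s_cancellative M \<longleftrightarrow>
      (\<forall>x \<in> carrier M. \<forall>y \<in> carrier M. \<forall>a \<in> carrier M. \<forall>P.
         x \<otimes> a = y \<otimes> a \<longrightarrow> monoid_primeideal P M \<longrightarrow> x \<notin> P \<longrightarrow> y \<notin> P \<longrightarrow>
         (\<exists>b \<in> carrier M. b \<notin> P \<and> x \<otimes> b = y \<otimes> b)))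
    \<and> (s_cancellative M \<longleftrightarrow>
      (\<forall>P Q. monoid_primeideal P M \<longrightarrow> monoid_primeideal Q M \<longrightarrow> Q \<subseteq> P \<longrightarrow>
         inj_on (localization_map M P Q) (Units (localization_at M P))))
    \<and> (s_cancellative M \<longleftrightarrow>
      (\<forall>x \<in> carrier M. \<forall>y \<in> carrier M. \<forall>a \<in> carrier M.
         x \<otimes> a = y \<otimes> a \<longrightarrow>
         (\<exists>b \<in> carrier M. b \<notin> primeideal_avoiding M (x \<otimes> y) \<and> x \<otimes> b = y \<otimes> b)))"
proof -
  interpret comm_monoid M by fact
  \<comment> \<open>For fixed \<open>x\<close>, \<open>y\<close>, \<open>a\<close> the equation does
    not involve \<open>P\<close>, so the quantifier over \<open>P\<close> moves past it and the
    comparison with the largest prime ideal applies pointwise.\<close>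
  have "s_cancellative M \<longleftrightarrow>
      (\<forall>x \<in> carrier M. \<forall>y \<in> carrier M. \<forall>a \<in> carrier M. \<forall>P.
         x \<otimes> a = y \<otimes> a \<longrightarrow> monoid_primeideal P M \<longrightarrow> x \<notin> P \<longrightarrow> y \<notin> P \<longrightarrow>
         (\<exists>b \<in> carrier M. b \<notin> P \<and> x \<otimes> b = y \<otimes> b))"
    unfolding s_cancellative_iff_avoiding
    by (simp add: equalizer_primeideals_iff_avoiding[symmetric])
  then show ?thesis
    unfolding inj_on_localization_map_iff using s_cancellative_iff_avoiding by simp
qed

end
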